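(* Let $V$ be a finite set and $w:V\to\mathbb{R}$ a function. Let $\pi$ be the random ranking of $V$ returned by $\mathrm{SortProc}(V,w)$, where $\mathrm{SortProc}$ is either $\mathrm{QuickSort}$ or $\mathrm{PlackettLuce}$. Then for any pair of distinct elements $u,v\in V$, $$\Pr[u\prec_\pi v]=\frac{e^{w(u)}}{e^{w(u)}+e^{w(v)}}.$$
   Context: A ranking of $V$ (with $|V|=n$) is a bijection $\pi:V\to\{1,\dots,n\}$, and $u\prec_\pi v$ means $\pi(u)<\pi(v)$. $\mathrm{QuickSort}(V,w)$: if $V=\emptyset$ return the empty list. Otherwise choose a pivot $p\in V$ uniformly at random; independently for each $v\in V\setminus\{p\}$, put $v$ in $V_L$ with probability $e^{w(v)}/(e^{w(v)}+e^{w(p)})$ and otherwise in $V_R$; return the concatenation of $\mathrm{QuickSort}(V_L,w)$, $p$, $\mathrm{QuickSort}(V_R,w)$, regarded as a ranking (the first element has position $1$, and so on), where the recursive calls use independent randomness. $\mathrm{PlackettLuce}(V,w)$: start with $U=V$. For $i=1,\dots,n$: choose a random $u\in U$ with probability proportional to $e^{w(u)}$, set $\pi(u)=i$, and remove $u$ from $U$. Return $\pi$. *)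

theory Defs
  imports "HOL-Probability.Probability"
begin

text \<open>
  A random ranking of a finite set \<open>V\<close> is a pmf on functions \<open>'a \<Rightarrow> nat\<close>. Only the values on \<open>V\<close>
  are meaningful; outside \<open>V\<close> a ranking takes arbitrary values.
\<close>

definition is_ranking :: "'a set \<Rightarrow> ('a \<Rightarrow> nat) \<Rightarrow> bool" where
  "is_ranking V \<pi> \<longleftrightarrow> bij_betw \<pi> V {1..card V}"

definition precedes :: "'a \<Rightarrow> ('a \<Rightarrow> nat) \<Rightarrow> 'a \<Rightarrow> bool"  ("(_ \<prec>\<^bsub>_\<^esub> _)" [51, 0, 51] 50) where
  "u \<prec>\<^bsub>\<pi>\<^esub> v \<longleftrightarrow> \<pi> u < \<pi> v"

definition ranking_of_list :: "'a list \<Rightarrow> 'a \<Rightarrow> nat" where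
  "ranking_of_list xs v = length (takeWhile (\<lambda>x. x \<noteq> v) xs) + 1"

lemma ranking_of_list_nth:
  assumes "distinct xs" "i < length xs"
  shows   "ranking_of_list xs (xs ! i) = i + 1"
proof -
  have "takeWhile (\<lambda>x. x \<noteq> xs ! i) xs = take i xs"
    using assms by (intro takeWhile_eq_take_P_nth) (auto simp: nth_eq_iff_index_eq)
  thus ?thesis using assms by (simp add: ranking_of_list_def)
qed

lemma is_ranking_ranking_of_list:
  assumes "distinct xs"
  shows   "is_ranking (set xs) (ranking_of_list xs)"
proof -
  have "inj_on (ranking_of_list xs) (set xs)"
    using assms by (auto simp: inj_on_def in_set_conv_nth ranking_of_list_nth)
  moreover have "ranking_of_list xs ` set xs = {1..length xs}"
  proof (intro equalityI subsetI)
    fix k assume "k \<in> {1..length xs}"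
    hence "xs ! (k - 1) \<in> set xs" "ranking_of_list xs (xs ! (k - 1)) = k"
      using assms by (auto simp: ranking_of_list_nth)
    thus "k \<in> ranking_of_list xs ` set xs" by force
  qed (use assms in \<open>auto simp: in_set_conv_nth ranking_of_list_nth\<close>)
  ultimately show ?thesis
    using assms by (simp add: is_ranking_def bij_betw_def distinct_card)
qed


text \<open>
  In the recursive case, \<open>b v\<close> is the outcome of the coin flip for \<open>v\<close>: \<open>b v\<close> holds iff \<open>v\<close> is put
  to the left of the pivot. The coin flips for different \<open>v\<close> are independent by the definition
  of \<^const>\<open>Pi_pmf\<close>. The equation for infinite sets only serves to make the function total.
\<close>

function quicksort_list :: "'a set \<Rightarrow> ('a \<Rightarrow> real) \<Rightarrow> 'a list pmf" where
  "quicksort_list {} w = return_pmf []"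
| "\<not>finite V \<Longrightarrow> quicksort_list V w = return_pmf []"
| "finite V \<Longrightarrow> V \<noteq> {} \<Longrightarrow>
     quicksort_list V w =
       do {
         p \<leftarrow> pmf_of_set V;
         b \<leftarrow> Pi_pmf (V - {p}) False
                (\<lambda>v. bernoulli_pmf (exp (w v) / (exp (w v) + exp (w p))));
         xs \<leftarrow> quicksort_list {v \<in> V - {p}. b v} w;
         ys \<leftarrow> quicksort_list {v \<in> V - {p}. \<not>b v} w;
         return_pmf (xs @ [p] @ ys)
       }"
  by simp_all fastforce
termination
proof (relation "Wellfounded.measure (\<lambda>(V, _). card V)")
  fix V :: "'a set" and w :: "'a \<Rightarrow> real" and p :: 'a and b :: "'a \<Rightarrow> bool"
  assume *: "finite V" "V \<noteq> {}" "p \<in> set_pmf (pmf_of_set V)"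
  have "card {v \<in> V - {p}. b v} < card V"
    using * by (intro psubset_card_mono) auto
  thus "(({v \<in> V - {p}. b v}, w), V, w) \<in> Wellfounded.measure (\<lambda>(V, _). card V)"
    by simp
next
  fix V :: "'a set" and w :: "'a \<Rightarrow> real" and p :: 'a and b :: "'a \<Rightarrow> bool"
  assume *: "finite V" "V \<noteq> {}" "p \<in> set_pmf (pmf_of_set V)"
  have "card {v \<in> V - {p}. \<not>b v} < card V"
    using * by (intro psubset_card_mono) auto
  thus "(({v \<in> V - {p}. \<not>b v}, w), V, w) \<in> Wellfounded.measure (\<lambda>(V, _). card V)"
    by simp
qed simp_all

definition QuickSort :: "'a set \<Rightarrow> ('a \<Rightarrow> real) \<Rightarrow> ('a \<Rightarrow> nat) pmf" where
  "QuickSort V w = map_pmf ranking_of_list (quicksort_list V w)"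

lemma quicksort_list_support:
  assumes "finite V" "zs \<in> set_pmf (quicksort_list V w)"
  shows   "distinct zs \<and> set zs = V"
  using assms
proof (induction V w arbitrary: zs rule: quicksort_list.induct)
  case (3 V w)
  from "3.prems" "3.hyps" obtain p b xs ys where
    p: "p \<in> set_pmf (pmf_of_set V)" and
    b: "b \<in> set_pmf (Pi_pmf (V - {p}) False
              (\<lambda>v. bernoulli_pmf (exp (w v) / (exp (w v) + exp (w p)))))" and
    xs: "xs \<in> set_pmf (quicksort_list {v \<in> V - {p}. b v} w)" and
    ys: "ys \<in> set_pmf (quicksort_list {v \<in> V - {p}. \<not>b v} w)" and
    zs: "zs = xs @ [p] @ ys"
    by (auto simp del: set_pmf_of_set)
  have "distinct xs \<and> set xs = {v \<in> V - {p}. b v}"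
    by (rule "3.IH"(1)[OF p b _ xs]) (use "3.hyps" in auto)
  moreover have "distinct ys \<and> set ys = {v \<in> V - {p}. \<not>b v}"
    by (rule "3.IH"(2)[OF p b xs _ ys]) (use "3.hyps" in auto)
  moreover have "p \<in> V" using p "3.hyps" by simp
  ultimately show ?case by (auto simp: zs)
qed auto

lemma QuickSort_is_ranking:
  assumes "finite V" "\<pi> \<in> set_pmf (QuickSort V w)"
  shows   "is_ranking V \<pi>"
  using assms by (auto simp: QuickSort_def dest!: quicksort_list_support
                       intro: is_ranking_ranking_of_list)


definition exp_weighted_pmf :: "'a set \<Rightarrow> ('a \<Rightarrow> real) \<Rightarrow> 'a pmf" where
  "exp_weighted_pmf U w =
     embed_pmf (\<lambda>u. if u \<in> U then exp (w u) / (\<Sum>x\<in>U. exp (w x)) else 0)"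

lemma pmf_exp_weighted_pmf:
  assumes "finite U" "U \<noteq> {}"
  shows   "pmf (exp_weighted_pmf U w) u =
             (if u \<in> U then exp (w u) / (\<Sum>x\<in>U. exp (w x)) else 0)"
  unfolding exp_weighted_pmf_def
proof (rule pmf_embed_pmf)
  have pos: "(\<Sum>x\<in>U. exp (w x)) > 0" using assms by (intro sum_pos) auto
  show "0 \<le> (if x \<in> U then exp (w x) / (\<Sum>x\<in>U. exp (w x)) else 0)" for x
    using pos by simp
  let ?f = "\<lambda>u. if u \<in> U then exp (w u) / (\<Sum>x\<in>U. exp (w x)) else 0"
  have "(\<integral>\<^sup>+ x. ennreal (?f x) \<partial>count_space UNIV) = (\<Sum>x\<in>U. ennreal (?f x))"
    using assms by (intro nn_integral_count_space'[of U]) auto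
  also have "\<dots> = ennreal (\<Sum>x\<in>U. ?f x)" using pos by (intro sum_ennreal) auto
  also have "(\<Sum>x\<in>U. ?f x) = 1" using pos by (simp flip: sum_divide_distrib)
  finally show "(\<integral>\<^sup>+ x. ennreal (?f x) \<partial>count_space UNIV) = 1" by simp
qed

lemma set_pmf_exp_weighted_pmf:
  assumes "finite U" "U \<noteq> {}"
  shows   "set_pmf (exp_weighted_pmf U w) = U"
proof -
  have "(\<Sum>x\<in>U. exp (w x)) > 0" using assms by (intro sum_pos) auto
  thus ?thesis using assms by (auto simp: set_pmf_eq pmf_exp_weighted_pmf)
qed

text \<open>
  The loop over the list of positions still to be assigned, with the set \<open>U\<close> of elements not yet
  ranked and the partial ranking \<open>\<pi>\<close> as its state. The initial \<open>\<pi>\<close> is overwritten on all of \<open>V\<close>.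
\<close>

primrec plackett_luce_loop ::
    "('a \<Rightarrow> real) \<Rightarrow> nat list \<Rightarrow> 'a set \<Rightarrow> ('a \<Rightarrow> nat) \<Rightarrow> ('a \<Rightarrow> nat) pmf" where
  "plackett_luce_loop w [] U \<pi> = return_pmf \<pi>"
| "plackett_luce_loop w (i # is) U \<pi> =
     do {
       u \<leftarrow> exp_weighted_pmf U w;
       plackett_luce_loop w is (U - {u}) (\<pi>(u := i))
     }"

definition PlackettLuce :: "'a set \<Rightarrow> ('a \<Rightarrow> real) \<Rightarrow> ('a \<Rightarrow> nat) pmf" where
  "PlackettLuce V w = plackett_luce_loop w [1..<card V + 1] V (\<lambda>_. 0)"

lemma plackett_luce_loop_support:
  assumes "finite U" "distinct is" "length is = card U"
  assumes "\<sigma> \<in> set_pmf (plackett_luce_loop w is U \<pi>)"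
  shows   "bij_betw \<sigma> U (set is) \<and> (\<forall>x. x \<notin> U \<longrightarrow> \<sigma> x = \<pi> x)"
  using assms
proof (induction "is" arbitrary: U \<pi>)
  case (Cons i "is")
  have U: "U \<noteq> {}" using Cons.prems by auto
  then obtain u where u: "u \<in> U"
    and \<sigma>: "\<sigma> \<in> set_pmf (plackett_luce_loop w is (U - {u}) (\<pi>(u := i)))"
    using Cons.prems by (auto simp: set_pmf_exp_weighted_pmf)
  have IH: "bij_betw \<sigma> (U - {u}) (set is) \<and> (\<forall>x. x \<notin> U - {u} \<longrightarrow> \<sigma> x = (\<pi>(u := i)) x)"
    by (rule Cons.IH[OF _ _ _ \<sigma>]) (use Cons.prems u in auto)
  hence "\<sigma> u = i" by simp
  moreover have "bij_betw \<sigma> (U - {u} \<union> {u}) (set is \<union> {\<sigma> u})"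
    using IH \<open>\<sigma> u = i\<close> Cons.prems(2) by (intro notIn_Un_bij_betw) auto
  ultimately show ?case using IH u by (auto simp: insert_absorb)
qed (auto simp: bij_betw_def)

lemma PlackettLuce_is_ranking:
  assumes "finite V" "\<pi> \<in> set_pmf (PlackettLuce V w)"
  shows   "is_ranking V \<pi>"
proof -
  have "bij_betw \<pi> V (set [1..<card V + 1])"
    using plackett_luce_loop_support[of V "[1..<card V + 1]" \<pi> w "\<lambda>_. 0"] assms
    by (simp add: PlackettLuce_def del: upt_Suc)
  moreover have "set [1..<card V + 1] = {1..card V}" by auto
  ultimately show ?thesis by (simp add: is_ranking_def)
qed

end

theory Submission
  imports Defs
begin

text \<open>
  For both algorithms the Boolean \<open>u \<prec> v\<close> is Bernoulli distributed with parameter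
  \<open>q = a / (a + b)\<close>, where \<open>a = e\<^bsup>w u\<^esup>\<close> and \<open>b = e\<^bsup>w v\<^esup>\<close>; this is shown by induction, conditioning
  on the first random choice.

  In QuickSort, a pivot in \<open>{u, v}\<close> compares \<open>u\<close> with \<open>v\<close> directly, with the right bias. Any other
  pivot, of weight \<open>c\<close>, puts \<open>u\<close> left and \<open>v\<close> right with probability \<open>a c / ((a + c) (b + c))\<close>, and
  leaves the decision to a recursive call with probability \<open>(a b + c\<^sup>2) / ((a + c) (b + c))\<close>. The claim
  is the identity \<open>a c + q (a b + c\<^sup>2) = q (a + c) (b + c)\<close>.

  In Plackett--Luce with total weight \<open>S\<close>, the first draw decides for \<open>u\<close> with probability \<open>a / S\<close>, for
  \<open>v\<close> with probability \<open>b / S\<close>, and otherwise leaves the decision to the rest of the loop, so the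
  claim is \<open>a / S + (1 - (a + b) / S) q = q\<close>.
\<close>

section \<open>Positions in concatenated lists\<close>

lemma ranking_of_list_append:
  "ranking_of_list (xs @ ys) x =
     (if x \<in> set xs then ranking_of_list xs x else length xs + ranking_of_list ys x)"
  by (auto simp: ranking_of_list_def takeWhile_append)

lemma ranking_of_list_Cons:
  "ranking_of_list (y # ys) x = (if x = y then 1 else Suc (ranking_of_list ys x))"
  by (auto simp: ranking_of_list_def)

lemma ranking_of_list_pos: "0 < ranking_of_list xs x"
  by (simp add: ranking_of_list_def)

lemma ranking_of_list_le_length:
  assumes "x \<in> set xs"
  shows   "ranking_of_list xs x \<le> length xs"
  using assms by (induction xs) (auto simp: ranking_of_list_Cons)

section \<open>Bernoulli distributions and independent coins\<close>

lemma bernoulli_pmf_eqI: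
  assumes "0 \<le> q" "q \<le> 1" "pmf P True = q"
  shows   "P = bernoulli_pmf q"
proof (rule pmf_eqI)
  fix i
  have "(\<Sum>i\<in>UNIV. pmf P i) = 1" by (intro sum_pmf_eq_1) auto
  thus "pmf P i = pmf (bernoulli_pmf q) i"
    using assms by (cases i) (auto simp: UNIV_bool)
qed

lemma map_Not_bernoulli_pmf:
  assumes "0 \<le> q" "q \<le> 1"
  shows   "map_pmf Not (bernoulli_pmf q) = bernoulli_pmf (1 - q)"
proof (rule bernoulli_pmf_eqI)
  show "pmf (map_pmf Not (bernoulli_pmf q)) True = 1 - q"
    using pmf_map_inj'[of Not "bernoulli_pmf q" False] assms by (simp add: inj_def)
qed (use assms in auto)

text \<open>Models a pivot of weight \<open>c\<close> other than the two compared elements, whose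
  coins are \<open>x\<close> and \<open>y\<close>. Equal coins send both to the same recursive call,
  which decides with bias \<open>q\<close> by induction; unequal coins make \<open>x\<close> the
  answer.\<close>

lemma bind_bernoulli_pair:
  assumes "0 < a" "0 < b" "0 < (c :: real)"
  defines "q \<equiv> a / (a + b)"
  shows   "do {
             x \<leftarrow> bernoulli_pmf (a / (a + c));
             y \<leftarrow> bernoulli_pmf (b / (b + c));
             if x = y then bernoulli_pmf q else return_pmf x
           } = bernoulli_pmf q"
proof (rule bernoulli_pmf_eqI)
  define \<alpha> \<beta> where "\<alpha> = a / (a + c)" and "\<beta> = b / (b + c)"
  have le: "0 \<le> \<alpha>" "\<alpha> \<le> 1" "0 \<le> \<beta>" "\<beta> \<le> 1" "0 \<le> q" "q \<le> 1"
    using assms by (auto simp: \<alpha>_def \<beta>_def q_def)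
  have compl: "1 - \<alpha> = c / (a + c)" "1 - \<beta> = c / (b + c)"
    using assms by (auto simp: \<alpha>_def \<beta>_def field_simps)
  have "pmf (do {
             x \<leftarrow> bernoulli_pmf \<alpha>;
             y \<leftarrow> bernoulli_pmf \<beta>;
             if x = y then bernoulli_pmf q else return_pmf x
           }) True = \<alpha> * (1 - \<beta>) + q * (\<alpha> * \<beta> + (1 - \<alpha>) * (1 - \<beta>))"
    using le by (simp add: pmf_bind algebra_simps)
  also have "\<dots> = (a * c + q * (a * b + c * c)) / ((a + c) * (b + c))"
    unfolding compl unfolding \<alpha>_def \<beta>_def
    by (simp only: times_divide_times_eq times_divide_eq_right times_divide_eq_left
      divide_divide_eq_left add_divide_distrib distrib_left)
  also have "a * c + q * (a * b + c * c) = q * ((a + c) * (b + c))"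
  proof -
    \<comment> \<open>The expansion isolates \<open>a + b\<close>, which cancels the denominator of
      \<open>q\<close>.\<close>
    have "q * ((a + c) * (b + c)) = q * (a + b) * c + q * (a * b + c * c)"
      by (simp add: algebra_simps)
    also have "q * (a + b) = a" using assms by (simp add: q_def)
    finally show ?thesis ..
  qed
  also have "q * ((a + c) * (b + c)) / ((a + c) * (b + c)) = q"
    using assms by simp
  finally show "pmf (do {
             x \<leftarrow> bernoulli_pmf (a / (a + c));
             y \<leftarrow> bernoulli_pmf (b / (b + c));
             if x = y then bernoulli_pmf q else return_pmf x
           }) True = q"
    by (simp add: \<alpha>_def \<beta>_def)
qed (use assms in auto)

text \<open>Peel the coordinate \<open>x\<close> off the product: it is independent of the function
  on the remaining indices, and \<open>y\<close> is still one of them because it differs from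
  \<open>x\<close>.\<close>

lemma map_Pi_pmf_pair:
  assumes "finite A" "x \<in> A" "y \<in> A" "x \<noteq> y"
  shows   "map_pmf (\<lambda>f. (f x, f y)) (Pi_pmf A d p) = pair_pmf (p x) (p y)"
proof -
  let ?B = "A - {x}"
  have "Pi_pmf A d p = map_pmf (\<lambda>(z, f). f(x := z)) (pair_pmf (p x) (Pi_pmf ?B d p))"
    using Pi_pmf_insert[of ?B x d p] assms by (simp add: insert_absorb)
  hence "map_pmf (\<lambda>f. (f x, f y)) (Pi_pmf A d p) =
           map_pmf (\<lambda>(z, f). (id z, f y)) (pair_pmf (p x) (Pi_pmf ?B d p))"
    using assms by (simp add: map_pmf_comp case_prod_unfold)
  also have "\<dots> = pair_pmf (map_pmf id (p x)) (map_pmf (\<lambda>f. f y) (Pi_pmf ?B d p))"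
    by (rule map_pair)
  also have "\<dots> = pair_pmf (p x) (p y)"
    using assms by (simp add: Pi_pmf_component pmf.map_id)
  finally show ?thesis .
qed

section \<open>QuickSort\<close>

lemma quicksort_list_precedes:
  assumes "finite V" "u \<in> V" "v \<in> V" "u \<noteq> v"
  shows   "map_pmf (\<lambda>xs. ranking_of_list xs u < ranking_of_list xs v) (quicksort_list V w) =
             bernoulli_pmf (exp (w u) / (exp (w u) + exp (w v)))"
  using assms
proof (induction V rule: finite_psubset_induct)
  case (psubset V)
  define q where "q = exp (w u) / (exp (w u) + exp (w v))"
  define E where "E xs \<longleftrightarrow> ranking_of_list xs u < ranking_of_list xs v" for xs
  define coin where "coin p x = bernoulli_pmf (exp (w x) / (exp (w x) + exp (w p)))" for p x
  define L where "L p b = {x \<in> V - {p}. b x}" for p b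
  define R where "R p b = {x \<in> V - {p}. \<not>b x}" for p b
  \<comment> \<open>The conditional law of the comparison, given the pivot and all coins.\<close>
  define rest where "rest p b = do {
      xs \<leftarrow> quicksort_list (L p b) w;
      ys \<leftarrow> quicksort_list (R p b) w;
      return_pmf (E (xs @ [p] @ ys))}" for p b
  have set_L: "set xs = L p b" if "xs \<in> set_pmf (quicksort_list (L p b) w)" for xs p b
    using quicksort_list_support[OF _ that] psubset.hyps by (simp add: L_def)
  have set_R: "set ys = R p b" if "ys \<in> set_pmf (quicksort_list (R p b) w)" for ys p b
    using quicksort_list_support[OF _ that] psubset.hyps by (simp add: R_def)

  have IH: "map_pmf E (quicksort_list U w) = bernoulli_pmf q"
    if "U \<subset> V" "u \<in> U" "v \<in> U" for U
    unfolding E_def q_def using psubset.IH[OF that] psubset.prems by simp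

  \<comment> \<open>If the coins already settle the comparison, the randomness of the recursive
    calls integrates out.\<close>
  have rest_const: "rest p b = return_pmf B"
    if "\<And>xs ys. set xs = L p b \<Longrightarrow> set ys = R p b \<Longrightarrow> E (xs @ [p] @ ys) = B" for p b B
  proof -
    have "rest p b = do {
        xs \<leftarrow> quicksort_list (L p b) w; ys \<leftarrow> quicksort_list (R p b) w; return_pmf B}"
      unfolding rest_def by (intro bind_pmf_cong refl arg_cong[of _ _ return_pmf] that set_L set_R)
    thus ?thesis by simp
  qed

  have "Pi_pmf (V - {p}) False (coin p) \<bind> rest p = bernoulli_pmf q" if "p \<in> V" for p
  proof -
    let ?P = "Pi_pmf (V - {p}) False (coin p)"
    consider "p = u" | "p = v" | "p \<noteq> u" "p \<noteq> v" by blast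
    thus ?thesis
    proof cases
      case 1
      have "rest p = (\<lambda>b. return_pmf (\<not>b v))"
      proof (intro ext rest_const)
        fix b xs ys assume "set xs = L p b"
        hence "v \<in> set xs \<longleftrightarrow> b v" "u \<notin> set xs"
          using 1 psubset.prems by (auto simp: L_def)
        \<comment> \<open>The pivot has position \<open>length xs + 1\<close>; elements of
          \<open>xs\<close> lie at or below \<open>length xs\<close>, and those of \<open>ys\<close>
          beyond the pivot.\<close>
        thus "E (xs @ [p] @ ys) = (\<not>b v)"
          using 1 psubset.prems ranking_of_list_le_length[of v xs] ranking_of_list_pos[of ys v]
          by (cases "b v") (auto simp: E_def ranking_of_list_append ranking_of_list_Cons)
      qed
      hence "?P \<bind> rest p = map_pmf Not (map_pmf (\<lambda>b. b v) ?P)"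
        by (simp add: map_pmf_def bind_assoc_pmf bind_return_pmf)
      also have "map_pmf (\<lambda>b. b v) ?P = coin p v"
        using 1 psubset by (subst Pi_pmf_component) auto
      \<comment> \<open>The coin gives the chance that \<open>v\<close> goes left of
        \<open>u\<close>, which is the complement of \<open>q\<close>.\<close>
      also have "map_pmf Not (coin p v) = bernoulli_pmf q"
      proof -
        have "exp (w u) + exp (w v) \<noteq> 0" using add_pos_pos[of "exp (w u)" "exp (w v)"] by simp
        hence "1 - exp (w v) / (exp (w v) + exp (w u)) = q"
          by (simp add: q_def field_simps)
        thus ?thesis unfolding coin_def 1
          by (subst map_Not_bernoulli_pmf) (auto simp: add_pos_pos)
      qed
      finally show ?thesis .
    next
      case 2
      have "rest p = (\<lambda>b. return_pmf (b u))"
      proof (intro ext rest_const)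
        fix b xs ys assume "set xs = L p b"
        hence "u \<in> set xs \<longleftrightarrow> b u" "v \<notin> set xs"
          using 2 psubset.prems by (auto simp: L_def)
        thus "E (xs @ [p] @ ys) = b u"
          using 2 psubset.prems ranking_of_list_le_length[of u xs] ranking_of_list_pos[of ys u]
          by (cases "b u") (auto simp: E_def ranking_of_list_append ranking_of_list_Cons)
      qed
      hence "?P \<bind> rest p = map_pmf (\<lambda>b. b u) ?P"
        by (simp add: map_pmf_def)
      also have "\<dots> = coin p u"
        using 2 psubset by (subst Pi_pmf_component) auto
      finally show ?thesis by (simp add: coin_def q_def 2)
    next
      case 3
      have "rest p b = (if b u = b v then bernoulli_pmf q else return_pmf (b u))" for b
      proof -
        consider "b u" "b v" | "\<not>b u" "\<not>b v" | "b u \<noteq> b v" by blast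
        thus ?thesis
        proof cases
          case 1
          have E: "E (xs @ [p] @ ys) = E xs" if "xs \<in> set_pmf (quicksort_list (L p b) w)" for xs ys
            using set_L[OF that] 1 3 psubset.prems
            by (simp add: E_def L_def ranking_of_list_append)
          have "rest p b = quicksort_list (L p b) w \<bind>
                  (\<lambda>xs. quicksort_list (R p b) w \<bind> (\<lambda>ys. return_pmf (E xs)))"
            unfolding rest_def by (intro bind_pmf_cong refl arg_cong[of _ _ return_pmf] E)
          also have "\<dots> = map_pmf E (quicksort_list (L p b) w)"
            by (simp add: map_pmf_def)
          also have "\<dots> = bernoulli_pmf q"
            by (rule IH) (use 1 3 that psubset.prems in \<open>auto simp: L_def\<close>)
          finally show ?thesis using 1 by simp
        next
          case 2
          \<comment> \<open>Both positions are shifted by \<open>length xs + 1\<close>, which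
            preserves their order.\<close>
          have E: "E (xs @ [p] @ ys) = E ys" if "xs \<in> set_pmf (quicksort_list (L p b) w)" for xs ys
            using set_L[OF that] 2 3 psubset.prems
            by (simp add: E_def L_def ranking_of_list_append ranking_of_list_Cons)
          have "rest p b = quicksort_list (L p b) w \<bind>
                  (\<lambda>xs. quicksort_list (R p b) w \<bind> (\<lambda>ys. return_pmf (E ys)))"
            unfolding rest_def by (intro bind_pmf_cong refl arg_cong[of _ _ return_pmf] E)
          also have "\<dots> = map_pmf E (quicksort_list (R p b) w)"
            by (simp add: map_pmf_def)
          also have "\<dots> = bernoulli_pmf q"
            by (rule IH) (use 2 3 that psubset.prems in \<open>auto simp: R_def\<close>)
          finally show ?thesis using 2 by simp
        next
          case neq: 3
          have "rest p b = return_pmf (b u)"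
          proof (rule rest_const)
            fix xs ys assume "set xs = L p b"
            hence "u \<in> set xs \<longleftrightarrow> b u" "v \<in> set xs \<longleftrightarrow> \<not>b u"
              using 3 neq psubset.prems by (auto simp: L_def)
            thus "E (xs @ [p] @ ys) = b u"
              using 3 ranking_of_list_le_length[of u xs] ranking_of_list_le_length[of v xs]
              by (cases "b u") (auto simp: E_def ranking_of_list_append ranking_of_list_Cons)
          qed
          thus ?thesis using neq by simp
        qed
      qed
      hence "rest p = (\<lambda>b. if b u = b v then bernoulli_pmf q else return_pmf (b u))" by blast
      \<comment> \<open>Only two coins matter, so the product can be projected onto their joint
        law.\<close>
      hence "?P \<bind> rest p = map_pmf (\<lambda>b. (b u, b v)) ?P \<bind>
               (\<lambda>(x, y). if x = y then bernoulli_pmf q else return_pmf x)"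
        by (simp add: bind_map_pmf)
      also have "map_pmf (\<lambda>b. (b u, b v)) ?P = pair_pmf (coin p u) (coin p v)"
        using 3 psubset by (intro map_Pi_pmf_pair) auto
      also have "\<dots> \<bind> (\<lambda>(x, y). if x = y then bernoulli_pmf q else return_pmf x) =
                   bernoulli_pmf q"
        using bind_bernoulli_pair[of "exp (w u)" "exp (w v)" "exp (w p)", folded q_def]
        by (simp add: pair_pmf_def bind_assoc_pmf bind_return_pmf coin_def)
      finally show ?thesis .
    qed
  qed
  moreover have "set_pmf (pmf_of_set V) = V"
    using psubset.hyps psubset.prems by (intro set_pmf_of_set) auto
  ultimately have "pmf_of_set V \<bind> (\<lambda>p. Pi_pmf (V - {p}) False (coin p) \<bind> rest p) =
           pmf_of_set V \<bind> (\<lambda>p. bernoulli_pmf q)"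
    by (intro bind_pmf_cong refl) simp
  moreover have "map_pmf E (quicksort_list V w) =
      pmf_of_set V \<bind> (\<lambda>p. Pi_pmf (V - {p}) False (coin p) \<bind> rest p)"
    using psubset.hyps psubset.prems
    by (subst quicksort_list.simps)
       (auto simp: map_bind_pmf rest_def[abs_def] coin_def[abs_def] L_def R_def)
  ultimately show ?case by (simp add: E_def[abs_def] q_def)
qed

section \<open>Plackett-Luce\<close>

text \<open>Position list and partial ranking are general because each iteration changes both.
  Strict increase makes an earlier draw a smaller position.\<close>

lemma plackett_luce_loop_precedes:
  assumes "finite U" "sorted_wrt (<) is" "length is = card U"
  assumes "u \<in> U" "v \<in> U" "u \<noteq> v"
  shows   "map_pmf (\<lambda>\<sigma>. \<sigma> u < \<sigma> v) (plackett_luce_loop w is U \<pi>) =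
             bernoulli_pmf (exp (w u) / (exp (w u) + exp (w v)))"
  using assms
proof (induction "is" arbitrary: U \<pi>)
  case (Cons i "is")
  define q where "q = exp (w u) / (exp (w u) + exp (w v))"
  define S where "S = (\<Sum>x\<in>U. exp (w x))"
  have q: "0 \<le> q" "q \<le> 1" by (auto simp: q_def add_pos_pos)
  have "U \<noteq> {}" using Cons.prems by auto
  note set_first = set_pmf_exp_weighted_pmf[OF Cons.prems(1) \<open>U \<noteq> {}\<close>, of w]
  have "S > 0" unfolding S_def using Cons.prems by (intro sum_pos) auto
  let ?loop = "\<lambda>x. plackett_luce_loop w is (U - {x}) (\<pi>(x := i))"
  \<comment> \<open>The conditional law of the comparison, given the first draw
    \<open>x\<close>.\<close>
  let ?next = "\<lambda>x. if x = u then return_pmf True else if x = v then return_pmf False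
                    else bernoulli_pmf q"
  have first: "\<sigma> x = i \<and> (\<forall>y\<in>U - {x}. i < \<sigma> y)"
    if "x \<in> U" "\<sigma> \<in> set_pmf (?loop x)" for x \<sigma>
  proof -
    have "bij_betw \<sigma> (U - {x}) (set is) \<and> (\<forall>y. y \<notin> U - {x} \<longrightarrow> \<sigma> y = (\<pi>(x := i)) y)"
      by (rule plackett_luce_loop_support[OF _ _ _ that(2)])
         (use Cons.prems that(1) in \<open>auto simp: strict_sorted_iff\<close>)
    thus ?thesis using Cons.prems(2) by (auto dest: bij_betwE)
  qed
  have "map_pmf (\<lambda>\<sigma>. \<sigma> u < \<sigma> v) (?loop x) = ?next x" if "x \<in> U" for x
  proof -
    consider "x = u" | "x = v" | "x \<noteq> u" "x \<noteq> v" by blast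
    thus ?thesis
    proof cases
      case 1
      have "\<sigma> u < \<sigma> v" if "\<sigma> \<in> set_pmf (?loop x)" for \<sigma>
        using first[OF \<open>x \<in> U\<close> that] Cons.prems 1 by auto
      hence "map_pmf (\<lambda>\<sigma>. \<sigma> u < \<sigma> v) (?loop x) = map_pmf (\<lambda>_. True) (?loop x)"
        by (intro map_pmf_cong refl) simp
      thus ?thesis using 1 by simp
    next
      case 2
      have "\<not>\<sigma> u < \<sigma> v" if "\<sigma> \<in> set_pmf (?loop x)" for \<sigma>
        using first[OF \<open>x \<in> U\<close> that] Cons.prems 2 by (auto simp: less_imp_le not_less)
      hence "map_pmf (\<lambda>\<sigma>. \<sigma> u < \<sigma> v) (?loop x) = map_pmf (\<lambda>_. False) (?loop x)"
        by (intro map_pmf_cong refl) simp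
      thus ?thesis using 2 Cons.prems by simp
    next
      case 3
      thus ?thesis using Cons.prems that by (simp add: Cons.IH q_def)
    qed
  qed
  hence "map_pmf (\<lambda>\<sigma>. \<sigma> u < \<sigma> v) (plackett_luce_loop w (i # is) U \<pi>) =
           exp_weighted_pmf U w \<bind> ?next"
    by (auto simp: map_bind_pmf set_first intro!: bind_pmf_cong)
  also have "\<dots> = bernoulli_pmf q"
  proof (rule bernoulli_pmf_eqI)
    have "pmf (exp_weighted_pmf U w \<bind> ?next) True =
            (\<Sum>x\<in>U. exp (w x) / S * pmf (?next x) True)"
      unfolding pmf_bind using Cons.prems \<open>U \<noteq> {}\<close>
      by (subst integral_measure_pmf[of U])
         (auto simp: set_first pmf_exp_weighted_pmf S_def intro!: sum.cong)
    \<comment> \<open>The three cases become the constant \<open>q\<close> with a correction of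
      \<open>1 - q\<close> at \<open>u\<close> and \<open>-q\<close> at \<open>v\<close>, so the sum
      splits.\<close>
    also have "\<dots> = (\<Sum>x\<in>U. q * (exp (w x) / S) + (if x = u then (1 - q) * (exp (w x) / S) else 0)
                       - (if x = v then q * (exp (w x) / S) else 0))"
      using Cons.prems q by (intro sum.cong) (auto simp: algebra_simps diff_divide_distrib)
    also have "\<dots> = q * (S / S) + (1 - q) * (exp (w u) / S) - q * (exp (w v) / S)"
      using Cons.prems
      by (simp add: sum.distrib sum_subtractf S_def flip: sum_distrib_left sum_divide_distrib)
    \<comment> \<open>The corrections are grouped so that they cancel by the choice of
      \<open>q\<close>.\<close>
    also have "\<dots> = q + (exp (w u) - q * (exp (w u) + exp (w v))) / S"
      using \<open>S > 0\<close> by (simp add: field_simps)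
    also have "q * (exp (w u) + exp (w v)) = exp (w u)"
      using add_pos_pos[of "exp (w u)" "exp (w v)"] by (simp add: q_def)
    finally show "pmf (exp_weighted_pmf U w \<bind> ?next) True = q" by simp
  qed (use q in auto)
  finally show ?case by (simp add: q_def)
qed auto

theorem lemma6p1:
  fixes V :: "'a set" and w :: "'a \<Rightarrow> real"
    and SortProc :: "'a set \<Rightarrow> ('a \<Rightarrow> real) \<Rightarrow> ('a \<Rightarrow> nat) pmf"
    and u v :: 'a
  assumes "finite V"
    and "SortProc = QuickSort \<or> SortProc = PlackettLuce"
    and "u \<in> V" and "v \<in> V" and "u \<noteq> v"
  shows "measure_pmf.prob (SortProc V w) {\<pi>. u \<prec>\<^bsub>\<pi>\<^esub> v} = exp (w u) / (exp (w u) + exp (w v))"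
proof -
  define q where "q = exp (w u) / (exp (w u) + exp (w v))"
  have q: "0 \<le> q" "q \<le> 1" by (auto simp: q_def add_pos_pos)
  have "map_pmf (\<lambda>\<pi>. u \<prec>\<^bsub>\<pi>\<^esub> v) (QuickSort V w) = bernoulli_pmf q"
    using assms quicksort_list_precedes
    by (simp add: QuickSort_def precedes_def map_pmf_comp q_def)
  moreover have "map_pmf (\<lambda>\<pi>. u \<prec>\<^bsub>\<pi>\<^esub> v) (PlackettLuce V w) = bernoulli_pmf q"
    unfolding PlackettLuce_def precedes_def q_def
    by (rule plackett_luce_loop_precedes) (use assms in \<open>auto simp del: upt_Suc\<close>)
  ultimately have "map_pmf (\<lambda>\<pi>. u \<prec>\<^bsub>\<pi>\<^esub> v) (SortProc V w) = bernoulli_pmf q"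
    using assms(2) by auto
  \<comment> \<open>The event is the preimage of \<open>True\<close>, so its probability is the mass
    at \<open>True\<close> of the pushforward.\<close>
  hence "measure_pmf.prob (SortProc V w) ((\<lambda>\<pi>. u \<prec>\<^bsub>\<pi>\<^esub> v) -` {True}) = q"
    using q by (simp flip: pmf_map)
  thus ?thesis by (simp add: vimage_def q_def)
qed

end
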